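(* For each $n$-point set $P\subset\mathbb{R}^2$ there exist a non-negative integer $\Lambda\le 25^n$ and an $n$-point set $P'\subset\{0,1,\dots,\Lambda\}^2$ with $S_{\square}(P')\ge S_{\square}(P)$.
   Context: An $n$-point set is a set of cardinality $n$ ($n$ a positive integer). For a finite set $P\subset\mathbb{R}^2$, $S_{\square}(P)$ denotes the number of squares contained in $P$, i.e. the number of $4$-element subsets of $P$ that are the vertex set of a (non-degenerate, arbitrarily oriented) square. *)

theory Defs
  imports "HOL-Analysis.Analysis"
begin

definition is_square :: "(real ^ 2) set \<Rightarrow> bool" where
  "is_square Q \<longleftrightarrow>
     (\<exists>a v w. v \<noteq> 0 \<and> orthogonal v w \<and> norm v = norm w \<and>
              Q = {a, a + v, a + v + w, a + w})"

lemma is_square_card: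
  assumes "is_square Q"
  shows "card Q = 4"
proof -
  obtain a v w where v: "v \<noteq> 0" and o: "orthogonal v w" and n: "norm v = norm w"
    and Q: "Q = {a, a + v, a + v + w, a + w}"
    using assms unfolding is_square_def by blast
  have w: "w \<noteq> 0" using v n by auto
  have "v \<noteq> w" using o v by (auto simp: orthogonal_def)
  moreover have "v + w \<noteq> 0"
  proof
    assume "v + w = 0"
    then have "w = - v" by (simp add: add_eq_0_iff)
    then show False using o v by (simp add: orthogonal_def)
  qed
  ultimately have "distinct [a, a + v, a + v + w, a + w]"
    using v w by (auto simp: add.assoc)
  then show ?thesis
    unfolding Q by (auto simp: card_insert_if)
qed

definition num_squares :: "(real ^ 2) set \<Rightarrow> nat" where
  "num_squares P = card {Q. Q \<subseteq> P \<and> is_square Q}"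

definition grid :: "nat \<Rightarrow> (real ^ 2) set" where
  "grid L = {p. \<forall>i. p $ i \<in> real ` {0..L}}"

end

theory Submission
  imports Defs
begin

text \<open>
  In complex coordinates, a square with corners \<open>a, b, c, d\<close> is a pair of linear relations
  \<open>d - a = \<i> (b - a)\<close> and \<open>c - b = d - a\<close>, whose coefficients are Gaussian integers of total
  size at most 4. It therefore suffices to replace the points by distinct small Gaussian integers
  satisfying the same relations. To separate two given points \<open>j\<close> and \<open>k\<close>, take a solution with
  \<open>u j \<noteq> u k\<close> that satisfies as many relations as possible, where relations \<open>u a = 0\<close> are
  included. Subtracting multiples shows that every nonzero vector satisfying the relations of \<open>u\<close>
  separates \<open>j\<close> and \<open>k\<close>. At most \<open>n - 1\<close> of these relations imply the others, so the pigeonhole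
  principle on the vectors with entries in \<open>{0..K} + \<i> {0..K}\<close>, where \<open>K + 1 = 8 ^ (n - 1)\<close>, yields
  such a vector with small Gaussian integer entries. A combination of these vectors over all
  pairs, with coefficients at most \<open>n\<^sup>2\<close>, separates all points at once, and
  \<open>2 n\<^sup>4 8 ^ (n - 1) \<le> 25 ^ n\<close>.
\<close>

section \<open>Small separating solutions of linear systems\<close>

text \<open>Gaussian elimination, by induction on the number of equations: an equation with a
  nonzero coefficient at \<open>s0\<close> is solved for that unknown, which is then eliminated from
  the other equations.\<close>

lemma underdetermined_system_nontrivial:
  fixes A :: "'t \<Rightarrow> 's \<Rightarrow> 'k::field"
  assumes "finite T" "finite S" "card T < card S"
  shows "\<exists>x. (\<exists>s\<in>S. x s \<noteq> 0) \<and> (\<forall>t\<in>T. (\<Sum>s\<in>S. A t s * x s) = 0)"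
  using assms
proof (induction T arbitrary: S A rule: finite_induct)
  case empty
  then have "S \<noteq> {}" by auto
  then show ?case by (intro exI[of _ "\<lambda>_. 1"]) auto
next
  case (insert t T)
  show ?case
  proof (cases "\<forall>s\<in>S. A t s = 0")
    case True
    have "card T < card S" using insert by simp
    from insert.IH[OF insert.prems(1) this, of A] True show ?thesis by auto
  next
    case False
    then obtain s0 where s0: "s0 \<in> S" "A t s0 \<noteq> 0" by blast
    define S' where "S' = S - {s0}"
    have fin: "finite S'" and card: "card T < card S'"
      using insert s0 by (auto simp: S'_def)
    obtain x where x: "\<exists>s\<in>S'. x s \<noteq> 0"
      "\<forall>t'\<in>T. (\<Sum>s\<in>S'. (A t' s - A t' s0 * A t s / A t s0) * x s) = 0"
      using insert.IH[OF fin card, of "\<lambda>t' s. A t' s - A t' s0 * A t s / A t s0"] by blast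
    \<comment> \<open>The value at \<open>s0\<close> is forced by equation \<open>t\<close>; the
      remaining equations then become the eliminated system solved by \<open>x\<close>.\<close>
    define y where "y = x(s0 := - (\<Sum>s\<in>S'. A t s * x s) / A t s0)"
    have split: "(\<Sum>s\<in>S. A t' s * y s)
      = (\<Sum>s\<in>S'. A t' s * x s) - A t' s0 / A t s0 * (\<Sum>s\<in>S'. A t s * x s)" for t'
    proof -
      have "(\<Sum>s\<in>S. A t' s * y s) = A t' s0 * y s0 + (\<Sum>s\<in>S'. A t' s * y s)"
        unfolding S'_def using s0 insert.prems(1) by (simp add: sum.remove)
      also have "(\<Sum>s\<in>S'. A t' s * y s) = (\<Sum>s\<in>S'. A t' s * x s)"
        by (rule sum.cong) (auto simp: y_def S'_def)
      finally show ?thesis by (simp add: y_def)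
    qed
    have "(\<Sum>s\<in>S. A t s * y s) = 0" using s0 by (simp add: split)
    moreover have "(\<Sum>s\<in>S. A t' s * y s) = 0" if "t' \<in> T" for t'
    proof -
      have "(\<Sum>s\<in>S'. A t' s * x s) - A t' s0 / A t s0 * (\<Sum>s\<in>S'. A t s * x s)
        = (\<Sum>s\<in>S'. (A t' s - A t' s0 * A t s / A t s0) * x s)"
        by (simp add: sum_distrib_left sum_subtractf[symmetric] algebra_simps)
      then show ?thesis using x(2) that by (simp add: split)
    qed
    moreover have "\<exists>s\<in>S. y s \<noteq> 0" using x(1) by (auto simp: y_def S'_def)
    ultimately show ?thesis by blast
  qed
qed

section \<open>Gaussian integer boxes and relations of bounded size\<close>

definition gauss_box :: "int \<Rightarrow> int \<Rightarrow> complex set" where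
  "gauss_box a b = (\<lambda>(i, j). Complex (of_int i) (of_int j)) ` ({a..b} \<times> {a..b})"

lemma finite_gauss_box [simp]: "finite (gauss_box a b)"
  by (simp add: gauss_box_def)

lemma card_gauss_box: "card (gauss_box a b) = (nat (b - a + 1))\<^sup>2"
proof -
  have "inj_on (\<lambda>(i, j). Complex (of_int i) (of_int j)) ({a..b} \<times> {a..b})"
    by (auto simp: inj_on_def)
  then show ?thesis
    by (simp add: gauss_box_def card_image card_cartesian_product power2_eq_square)
qed

lemma gauss_box_iff:
  "z \<in> gauss_box a b \<longleftrightarrow> Re z \<in> \<int> \<and> Im z \<in> \<int> \<and>
     of_int a \<le> Re z \<and> Re z \<le> of_int b \<and> of_int a \<le> Im z \<and> Im z \<le> of_int b"
proof
  assume "z \<in> gauss_box a b"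
  then show "Re z \<in> \<int> \<and> Im z \<in> \<int> \<and>
     of_int a \<le> Re z \<and> Re z \<le> of_int b \<and> of_int a \<le> Im z \<and> Im z \<le> of_int b"
    by (auto simp: gauss_box_def)
next
  assume R: "Re z \<in> \<int> \<and> Im z \<in> \<int> \<and>
     of_int a \<le> Re z \<and> Re z \<le> of_int b \<and> of_int a \<le> Im z \<and> Im z \<le> of_int b"
  then obtain i j where "Re z = of_int i" "Im z = of_int j" by (auto elim!: Ints_cases)
  with R have "z = Complex (of_int i) (of_int j)" "(i, j) \<in> {a..b} \<times> {a..b}"
    by (auto simp: complex_eq_iff)
  then show "z \<in> gauss_box a b" unfolding gauss_box_def by force
qed

text \<open>Extensional coefficient vectors of bounded size form a finite set when \<open>P\<close>
  is finite, so relations can be counted. That \<open>w\<close> satisfies every bounded relation of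
  \<open>z\<close> becomes the inclusion
  \<open>relations L P z \<subseteq> relations L P w\<close>.\<close>

definition relations :: "nat \<Rightarrow> 'a set \<Rightarrow> ('a \<Rightarrow> complex) \<Rightarrow> ('a \<Rightarrow> complex) set" where
  "relations L P z = {c \<in> P \<rightarrow>\<^sub>E {x. Re x \<in> \<int> \<and> Im x \<in> \<int>}.
     (\<Sum>p\<in>P. \<bar>Re (c p)\<bar> + \<bar>Im (c p)\<bar>) \<le> real L \<and> (\<Sum>p\<in>P. c p * z p) = 0}"

lemma relations_eq_zero: "c \<in> relations L P z \<Longrightarrow> (\<Sum>p\<in>P. c p * z p) = 0"
  by (simp add: relations_def)

lemma relations_transfer:
  "c \<in> relations L P z \<Longrightarrow> (\<Sum>p\<in>P. c p * w p) = 0 \<Longrightarrow> c \<in> relations L P w"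
  by (simp add: relations_def)

lemma finite_relations:
  assumes "finite P"
  shows "finite (relations L P z)"
proof (rule finite_subset)
  show "relations L P z \<subseteq> P \<rightarrow>\<^sub>E gauss_box (- int L) (int L)"
  proof
    fix c assume c: "c \<in> relations L P z"
    have "c p \<in> gauss_box (- int L) (int L)" if p: "p \<in> P" for p
    proof -
      have "\<bar>Re (c p)\<bar> + \<bar>Im (c p)\<bar> \<le> (\<Sum>p\<in>P. \<bar>Re (c p)\<bar> + \<bar>Im (c p)\<bar>)"
        using assms p by (intro member_le_sum) auto
      also have "\<dots> \<le> real L" using c by (simp add: relations_def)
      finally show ?thesis using c p by (auto simp: gauss_box_iff relations_def PiE_iff)
    qed
    then show "c \<in> P \<rightarrow>\<^sub>E gauss_box (- int L) (int L)"
      using c by (auto simp: relations_def PiE_iff)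
  qed
  show "finite (P \<rightarrow>\<^sub>E gauss_box (- int L) (int L))"
    using assms by (intro finite_PiE) auto
qed

text \<open>Both parts of \<open>c p * x p\<close> are at most
  \<open>(\<bar>Re (c p)\<bar> + \<bar>Im (c p)\<bar>) * K\<close> in absolute value, and the first
  factors sum to at most \<open>L\<close>. This bounds the number of possible values in the
  pigeonhole argument.\<close>

lemma relation_value_in_box:
  assumes c: "c \<in> relations L P z" and x: "x \<in> P \<rightarrow> gauss_box 0 (int K)"
  shows "(\<Sum>p\<in>P. c p * x p) \<in> gauss_box (- int (L * K)) (int (L * K))"
proof -
  have le: "\<bar>s * a - t * b\<bar> \<le> (\<bar>s\<bar> + \<bar>t\<bar>) * real K" "\<bar>s * a + t * b\<bar> \<le> (\<bar>s\<bar> + \<bar>t\<bar>) * real K"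
    if "0 \<le> a" "a \<le> real K" "0 \<le> b" "b \<le> real K" for s t a b :: real
  proof -
    have "\<bar>s * a\<bar> \<le> \<bar>s\<bar> * real K" "\<bar>t * b\<bar> \<le> \<bar>t\<bar> * real K"
      using that by (auto simp: abs_mult intro!: mult_left_mono)
    then show "\<bar>s * a - t * b\<bar> \<le> (\<bar>s\<bar> + \<bar>t\<bar>) * real K" "\<bar>s * a + t * b\<bar> \<le> (\<bar>s\<bar> + \<bar>t\<bar>) * real K"
      by (auto simp: algebra_simps)
  qed
  have xp: "Re (x p) \<in> \<int>" "Im (x p) \<in> \<int>" "0 \<le> Re (x p)" "Re (x p) \<le> real K"
    "0 \<le> Im (x p)" "Im (x p) \<le> real K" if "p \<in> P" for p
    using x that by (auto simp: gauss_box_iff Pi_iff)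
  have cp: "Re (c p) \<in> \<int>" "Im (c p) \<in> \<int>" if "p \<in> P" for p
    using c that by (auto simp: relations_def PiE_iff)
  have bound: "(\<Sum>p\<in>P. (\<bar>Re (c p)\<bar> + \<bar>Im (c p)\<bar>) * real K) \<le> real (L * K)"
    using c by (auto simp: relations_def sum_distrib_right[symmetric] intro!: mult_right_mono)
  have "\<bar>Re (\<Sum>p\<in>P. c p * x p)\<bar> \<le> (\<Sum>p\<in>P. (\<bar>Re (c p)\<bar> + \<bar>Im (c p)\<bar>) * real K)"
    unfolding Re_sum by (rule order_trans[OF sum_abs sum_mono]) (auto intro!: le xp)
  moreover have "\<bar>Im (\<Sum>p\<in>P. c p * x p)\<bar> \<le> (\<Sum>p\<in>P. (\<bar>Re (c p)\<bar> + \<bar>Im (c p)\<bar>) * real K)"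
    unfolding Im_sum by (rule order_trans[OF sum_abs sum_mono]) (auto intro!: le xp)
  moreover have "Re (\<Sum>p\<in>P. c p * x p) \<in> \<int>" "Im (\<Sum>p\<in>P. c p * x p) \<in> \<int>"
    using xp cp by (auto intro!: Ints_sum)
  ultimately show ?thesis using bound unfolding gauss_box_iff by auto
qed

section \<open>Extremal and small separating solutions\<close>

text \<open>Take \<open>u\<close> with the most relations. If some \<open>v\<close> with all these
  relations had \<open>v j = v k\<close> and \<open>v a \<noteq> 0\<close>, clearing coordinate
  \<open>a\<close> of \<open>u\<close> by a multiple of \<open>v\<close> would keep the separation
  and all relations and gain one more.\<close>

lemma exists_extremal_separating_solution:
  fixes z :: "'a \<Rightarrow> complex"
  assumes P: "finite P" and L: "L \<ge> 1" and sep: "z j \<noteq> z k"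
  shows "\<exists>u. u j \<noteq> u k \<and> relations L P z \<subseteq> relations L P u \<and>
    (\<forall>v. relations L P u \<subseteq> relations L P v \<longrightarrow> (\<exists>a\<in>P. v a \<noteq> 0) \<longrightarrow> v j \<noteq> v k)"
proof -
  define Q where "Q = (\<lambda>u. u j \<noteq> u k \<and> relations L P z \<subseteq> relations L P u)"
  define U :: "('a \<Rightarrow> complex) set" where
    "U = {c \<in> P \<rightarrow>\<^sub>E {x. Re x \<in> \<int> \<and> Im x \<in> \<int>}. (\<Sum>p\<in>P. \<bar>Re (c p)\<bar> + \<bar>Im (c p)\<bar>) \<le> real L}"
  \<comment> \<open>Every bounded coefficient vector is a relation of the zero vector, so there are
    finitely many in all and a maximum is attained.\<close>
  have "U = relations L P (\<lambda>_. 0)" by (auto simp: U_def relations_def)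
  then have finU: "finite U" using finite_relations[OF P] by metis
  have sub: "relations L P u \<subseteq> U" for u by (auto simp: U_def relations_def)
  have "Q z" using sep by (simp add: Q_def)
  then obtain u where u: "Q u" "\<And>v. Q v \<Longrightarrow> card (relations L P v) \<le> card (relations L P u)"
    using ex_has_greatest_nat[of Q z "\<lambda>u. card (relations L P u)" "card U + 1"]
      card_mono[OF finU sub] by (metis le_imp_less_Suc Suc_eq_plus1)
  have "v j \<noteq> v k" if v: "relations L P u \<subseteq> relations L P v" and a: "a \<in> P" "v a \<noteq> 0" for v a
  proof
    assume eq: "v j = v k"
    define u' where "u' = (\<lambda>p. u p - u a / v a * v p)"
    \<comment> \<open>The unit vector at \<open>a\<close> encodes the relation that coordinate
      \<open>a\<close> vanishes; its size is 1, hence \<open>L \<ge> 1\<close>.\<close>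
    define d :: "'a \<Rightarrow> complex" where "d = restrict (\<lambda>p. if p = a then 1 else 0) P"
    have d_sum: "(\<Sum>p\<in>P. d p * w p) = w a" for w
    proof -
      have "(\<Sum>p\<in>P. d p * w p) = (\<Sum>p\<in>P. if p = a then w p else 0)"
        by (rule sum.cong) (auto simp: d_def)
      then show ?thesis using P a by simp
    qed
    have "(\<Sum>p\<in>P. \<bar>Re (d p)\<bar> + \<bar>Im (d p)\<bar>) = (\<Sum>p\<in>P. if p = a then 1 else 0)"
      by (rule sum.cong) (auto simp: d_def)
    then have d_rel: "d \<in> relations L P w \<longleftrightarrow> w a = 0" for w
      using P a L by (auto simp: relations_def d_sum) (auto simp: d_def)
    have le: "relations L P u \<subseteq> relations L P u'"
    proof
      fix c assume c: "c \<in> relations L P u"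
      have "(\<Sum>p\<in>P. c p * u' p) = (\<Sum>p\<in>P. c p * u p) - u a / v a * (\<Sum>p\<in>P. c p * v p)"
        by (simp add: u'_def sum_distrib_left sum_subtractf[symmetric] algebra_simps)
      also have "\<dots> = 0" using relations_eq_zero[OF c] relations_eq_zero[OF subsetD[OF v c]] by simp
      finally show "c \<in> relations L P u'" using c by (rule relations_transfer[rotated])
    qed
    have "d \<in> relations L P u'" using a by (simp add: d_rel u'_def)
    \<comment> \<open>If \<open>d\<close> were a relation of \<open>u\<close>, it would be one of
      \<open>v\<close>, contrary to \<open>v a \<noteq> 0\<close>.\<close>
    moreover have "d \<notin> relations L P u" using subsetD[OF v, of d] a by (auto simp: d_rel)
    ultimately have "relations L P u \<subset> relations L P u'" using le by blast
    then have "card (relations L P u) < card (relations L P u')"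
      by (intro psubset_card_mono finite_relations P)
    moreover have "Q u'" using u(1) eq le by (auto simp: Q_def u'_def)
    ultimately show False using u(2) by fastforce
  qed
  then show ?thesis using u(1) unfolding Q_def by blast
qed

text \<open>Let \<open>F\<close> be a set of least cardinality among those implying all relations of
  \<open>u\<close>. Dropping any \<open>f\<close> breaks the implication, and a witness of the
  failure is annihilated by the rest of \<open>F\<close> but not by \<open>f\<close>. Since
  \<open>u\<close> is nonzero and annihilated by all of \<open>F\<close>, there is room for fewer
  than \<open>card P\<close> such dual vectors.\<close>

lemma relations_rank_bound:
  fixes u :: "'a \<Rightarrow> complex"
  assumes P: "finite P" and nz: "\<exists>a\<in>P. u a \<noteq> 0"
  shows "\<exists>F \<subseteq> relations L P u. card F < card P \<and>
    (\<forall>v. F \<subseteq> relations L P v \<longrightarrow> relations L P u \<subseteq> relations L P v)"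
proof -
  define G where "G = (\<lambda>F. F \<subseteq> relations L P u \<and>
    (\<forall>v. F \<subseteq> relations L P v \<longrightarrow> relations L P u \<subseteq> relations L P v))"
  have "G (relations L P u)" by (simp add: G_def)
  then obtain F where F: "G F" "\<And>F'. G F' \<Longrightarrow> card F \<le> card F'"
    using ex_has_least_nat[of G _ card] by blast
  have sub: "F \<subseteq> relations L P u" using F(1) by (simp add: G_def)
  then have finF: "finite F" using finite_relations[OF P] finite_subset by blast
  have "\<exists>y. (\<Sum>p\<in>P. f p * y p) \<noteq> 0 \<and> (\<forall>g\<in>F - {f}. (\<Sum>p\<in>P. g p * y p) = 0)"
    if f: "f \<in> F" for f
  proof -
    have "\<not> G (F - {f})" using F(2)[of "F - {f}"] finF f
      by (metis card_Diff1_less not_le)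
    then obtain v where v: "F - {f} \<subseteq> relations L P v" "\<not> relations L P u \<subseteq> relations L P v"
      using sub by (auto simp: G_def)
    then have "\<not> F \<subseteq> relations L P v" using F(1) by (auto simp: G_def)
    then have "f \<notin> relations L P v" using v by blast
    then have "(\<Sum>p\<in>P. f p * v p) \<noteq> 0" using sub f relations_transfer by blast
    then show ?thesis using v(1) relations_eq_zero by blast
  qed
  then obtain y where y: "\<And>f. f \<in> F \<Longrightarrow> (\<Sum>p\<in>P. f p * y f p) \<noteq> 0"
    "\<And>f g. f \<in> F \<Longrightarrow> g \<in> F \<Longrightarrow> g \<noteq> f \<Longrightarrow> (\<Sum>p\<in>P. g p * y f p) = 0"
    by (metis Diff_iff singletonD)
  \<comment> \<open>The dual vectors \<open>y f\<close> together with \<open>u\<close> itself are linearly independent.\<close>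
  have "card F < card P"
  proof (rule ccontr)
    assume "\<not> card F < card P"
    \<comment> \<open>The index \<open>None\<close> stands for \<open>u\<close> and
      \<open>Some f\<close> for \<open>y f\<close>: one vector more than \<open>F\<close> has
      elements, hence a nontrivial dependence.\<close>
    then have "card P < card (insert None (Some ` F))"
      using finF by (simp add: card_image)
    then obtain x where x: "\<exists>s\<in>insert None (Some ` F). x s \<noteq> 0"
      "\<forall>p\<in>P. (\<Sum>s\<in>insert None (Some ` F). (case s of None \<Rightarrow> u p | Some f \<Rightarrow> y f p) * x s) = 0"
      using underdetermined_system_nontrivial[OF P, of "insert None (Some ` F)"
          "\<lambda>p s. case s of None \<Rightarrow> u p | Some f \<Rightarrow> y f p"] finF by auto
    have eq: "u p * x None + (\<Sum>f\<in>F. y f p * x (Some f)) = 0" if "p \<in> P" for p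
      using x(2) that finF by (simp add: sum.reindex)
    have zero: "x (Some g) = 0" if g: "g \<in> F" for g
    proof -
      \<comment> \<open>Applying \<open>g\<close> to the dependence kills \<open>u\<close> and every
        \<open>y f\<close> with \<open>f \<noteq> g\<close>, which isolates the coefficient of
        \<open>y g\<close>.\<close>
      have "0 = (\<Sum>p\<in>P. g p * (u p * x None + (\<Sum>f\<in>F. y f p * x (Some f))))"
        using eq by simp
      also have "\<dots> = (\<Sum>p\<in>P. g p * u p) * x None
          + (\<Sum>p\<in>P. \<Sum>f\<in>F. g p * y f p * x (Some f))"
        by (simp add: algebra_simps sum.distrib sum_distrib_left)
      also have "(\<Sum>p\<in>P. \<Sum>f\<in>F. g p * y f p * x (Some f))
          = (\<Sum>f\<in>F. (\<Sum>p\<in>P. g p * y f p) * x (Some f))"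
        by (subst sum.swap) (simp add: sum_distrib_right)
      also have "\<dots> = (\<Sum>f\<in>F. if f = g then (\<Sum>p\<in>P. g p * y g p) * x (Some g) else 0)"
        using y(2) g by (intro sum.cong) auto
      also have "(\<Sum>p\<in>P. g p * u p) = 0" using sub g by (auto intro: relations_eq_zero)
      finally show ?thesis using y(1)[OF g] finF g by simp
    qed
    then have "x None \<noteq> 0" using x(1) by auto
    then show False using eq zero nz by auto
  qed
  then show ?thesis using F(1) unfolding G_def by blast
qed

text \<open>Pigeonhole in the manner of Siegel's lemma: evaluating the few relations
  \<open>F\<close> on vectors with entries in the box from 0 to \<open>K\<close> cannot be
  injective, and the difference of two colliding vectors satisfies \<open>F\<close>. By extremality
  of \<open>u\<close>, being nonzero suffices for it to separate \<open>j\<close> and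
  \<open>k\<close>.\<close>

lemma exists_small_separating_solution:
  fixes z :: "'a \<Rightarrow> complex"
  assumes P: "finite P" "j \<in> P" "k \<in> P" and L: "L \<ge> 1" and sep: "z j \<noteq> z k"
    and K: "K + 1 = (2 * L) ^ (card P - 1)"
  shows "\<exists>v. v j \<noteq> v k \<and> relations L P z \<subseteq> relations L P v \<and>
    (\<forall>p\<in>P. v p \<in> gauss_box (- int K) (int K))"
proof -
  obtain u where u: "u j \<noteq> u k" "relations L P z \<subseteq> relations L P u"
    "\<And>v. relations L P u \<subseteq> relations L P v \<Longrightarrow> \<exists>a\<in>P. v a \<noteq> 0 \<Longrightarrow> v j \<noteq> v k"
    using exists_extremal_separating_solution[of P L z j k] P L sep by blast
  have "\<exists>a\<in>P. u a \<noteq> 0" using u(1) P by metis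
  then obtain F where F: "F \<subseteq> relations L P u" "card F < card P"
    "\<And>v. F \<subseteq> relations L P v \<Longrightarrow> relations L P u \<subseteq> relations L P v"
    using relations_rank_bound[OF P(1)] by metis
  have finF: "finite F" using F(1) finite_relations[OF P(1)] finite_subset by blast
  have "card {j, k} \<le> card P" using P by (intro card_mono) auto
  then have n2: "card P \<ge> 2" using sep by (cases "j = k") auto
  define X where "X = P \<rightarrow>\<^sub>E gauss_box 0 (int K)"
  define Y where "Y = F \<rightarrow>\<^sub>E gauss_box (- int (L * K)) (int (L * K))"
  define h where "h = (\<lambda>x. restrict (\<lambda>c. \<Sum>p\<in>P. c p * x p) F)"
  have "h ` X \<subseteq> Y"
    using relation_value_in_box[of _ L P u _ K] F(1)
    by (auto simp: h_def X_def Y_def PiE_iff Pi_iff subset_iff)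
  moreover have "finite Y" unfolding Y_def using finF by (intro finite_PiE) auto
  ultimately have "card (h ` X) \<le> card Y" by (intro card_mono)
  also have "card Y = ((2 * L * K + 1)\<^sup>2) ^ card F"
  proof -
    have "int (L * K) - - int (L * K) + 1 = int (2 * L * K + 1)" by simp
    then have "nat (int (L * K) - - int (L * K) + 1) = 2 * L * K + 1" by (simp only: nat_int)
    then show ?thesis unfolding Y_def using finF by (simp add: card_PiE card_gauss_box)
  qed
  also have "\<dots> \<le> ((2 * L * K + 1)\<^sup>2) ^ (card P - 1)"
    using F(2) by (intro power_increasing) auto
  \<comment> \<open>By \<open>n2\<close> the exponent is positive, so the strict inequality of the
    bases survives the power.\<close>
  also have "\<dots> < ((2 * L * (K + 1))\<^sup>2) ^ (card P - 1)"
  proof (intro power_strict_mono)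
    show "2 * L * K + 1 < 2 * L * (K + 1)" using L by simp
  qed (use n2 in auto)
  also have "\<dots> = (((2 * L) ^ (card P - 1))\<^sup>2) * ((K + 1)\<^sup>2) ^ (card P - 1)"
    by (simp only: power_mult_distrib power_mult[symmetric] mult.commute[of 2])
  \<comment> \<open>The choice of \<open>K\<close> enters here: the factor contributed by
    \<open>2 * L\<close> is exactly \<open>(K + 1)\<^sup>2\<close>, the number of values of one more
    entry.\<close>
  also have "\<dots> = ((K + 1)\<^sup>2) ^ Suc (card P - 1)" by (simp only: K[symmetric] power_Suc)
  also have "\<dots> = card X"
    using n2 P by (simp add: X_def card_PiE card_gauss_box nat_add_distrib)
  finally have "\<not> inj_on h X" by (rule pigeonhole)
  then obtain x y where xy: "x \<in> X" "y \<in> X" "x \<noteq> y" "h x = h y" by (auto simp: inj_on_def)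
  define v where "v = (\<lambda>p. x p - y p)"
  have "F \<subseteq> relations L P v"
  proof
    fix c assume c: "c \<in> F"
    have "(\<Sum>p\<in>P. c p * x p) = (\<Sum>p\<in>P. c p * y p)"
      using fun_cong[OF xy(4), of c] c by (simp add: h_def)
    then have "(\<Sum>p\<in>P. c p * v p) = 0"
      by (simp add: v_def right_diff_distrib sum_subtractf)
    then show "c \<in> relations L P v" using c F(1) relations_transfer by blast
  qed
  then have rel: "relations L P u \<subseteq> relations L P v" by (rule F(3))
  \<comment> \<open>Members of \<open>X\<close> are extensional, so two different ones differ at a
    point of \<open>P\<close>.\<close>
  have "\<exists>a\<in>P. v a \<noteq> 0"
  proof (rule ccontr)
    assume "\<not> ?thesis"
    then have "x = y" using xy(1,2) unfolding X_def by (intro PiE_ext) (auto simp: v_def)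
    with xy show False by simp
  qed
  then have "v j \<noteq> v k" using u(3)[OF rel] by blast
  moreover have "v p \<in> gauss_box (- int K) (int K)" if "p \<in> P" for p
  proof -
    have "x p \<in> gauss_box 0 (int K)" "y p \<in> gauss_box 0 (int K)"
      using xy that by (auto simp: X_def)
    then show ?thesis unfolding gauss_box_iff v_def by auto
  qed
  ultimately show ?thesis using u(2) rel by blast
qed

section \<open>One small solution separating all points\<close>

text \<open>The coefficients are chosen one at a time. Of the \<open>(card P)\<^sup>2 + 1\<close>
  candidates for the next one, the ordered pairs of points exclude at most
  \<open>(card P)\<^sup>2\<close>.\<close>

lemma exists_separating_combination:
  fixes v :: "'e \<Rightarrow> 'a \<Rightarrow> complex"
  assumes "finite P" "finite E"
  shows "\<exists>c :: 'e \<Rightarrow> nat. (\<forall>e. c e \<le> (card P)\<^sup>2) \<and>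
    (\<forall>p\<in>P. \<forall>q\<in>P. (\<exists>e\<in>E. v e p \<noteq> v e q) \<longrightarrow>
      (\<Sum>e\<in>E. of_nat (c e) * v e p) \<noteq> (\<Sum>e\<in>E. of_nat (c e) * v e q))"
  using assms(2)
proof (induction E rule: finite_induct)
  case empty
  then show ?case by (intro exI[of _ "\<lambda>_. 0"]) auto
next
  case (insert e E)
  then obtain c :: "'e \<Rightarrow> nat" where c: "\<forall>e. c e \<le> (card P)\<^sup>2"
    "\<forall>p\<in>P. \<forall>q\<in>P. (\<exists>e\<in>E. v e p \<noteq> v e q) \<longrightarrow>
      (\<Sum>e\<in>E. of_nat (c e) * v e p) \<noteq> (\<Sum>e\<in>E. of_nat (c e) * v e q)" by blast
  define w where "w = (\<lambda>p. \<Sum>e\<in>E. of_nat (c e) * v e p)"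
  \<comment> \<open>Each pair excludes at most one value for the coefficient of the new vector.\<close>
  define bad where "bad = (\<lambda>(p, q). SOME t::nat. w p + of_nat t * v e p = w q + of_nat t * v e q)"
  have "card (bad ` (P \<times> P)) \<le> card (P \<times> P)" using assms(1) by (intro card_image_le) auto
  also have "\<dots> < card {..(card P)\<^sup>2}" by (simp add: card_cartesian_product power2_eq_square)
  finally have "\<not> {..(card P)\<^sup>2} \<subseteq> bad ` (P \<times> P)"
    using assms(1) card_mono[of "bad ` (P \<times> P)"] by (meson finite_SigmaI finite_imageI not_le)
  then obtain t where t: "t \<le> (card P)\<^sup>2" "t \<notin> bad ` (P \<times> P)" by auto
  define c' where "c' = c(e := t)"
  have c'_sum: "(\<Sum>e\<in>insert e E. of_nat (c' e) * v e p) = w p + of_nat t * v e p" for p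
  proof -
    have "(\<Sum>e\<in>E. of_nat (c' e) * v e p) = w p"
      unfolding w_def using insert(2) by (intro sum.cong) (auto simp: c'_def)
    then show ?thesis using insert(1,2) by (simp add: c'_def)
  qed
  have "w p + of_nat t * v e p \<noteq> w q + of_nat t * v e q"
    if pq: "p \<in> P" "q \<in> P" and sep: "\<exists>f\<in>insert e E. v f p \<noteq> v f q" for p q
  proof
    assume eq: "w p + of_nat t * v e p = w q + of_nat t * v e q"
    \<comment> \<open>The choice in \<open>bad\<close> is arbitrary when no collision exists; given
      a collision at \<open>t\<close>, it yields a collision at some \<open>s \<noteq> t\<close>.
      Two collisions force equality of both \<open>v e\<close> and \<open>w\<close> at
      \<open>p\<close> and \<open>q\<close>.\<close>
    define s where "s = bad (p, q)"
    have s: "w p + of_nat s * v e p = w q + of_nat s * v e q"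
      unfolding s_def bad_def prod.case
      using eq by (rule someI[where P = "\<lambda>t::nat. w p + of_nat t * v e p = w q + of_nat t * v e q"])
    have "s \<noteq> t" using t(2) pq by (auto simp: s_def)
    have "(of_nat s - of_nat t) * (v e p - v e q) = 0" using eq s by algebra
    with \<open>s \<noteq> t\<close> have ve: "v e p = v e q" by simp
    then have "w p = w q" using eq by simp
    with c(2) pq have "\<forall>f\<in>E. v f p = v f q" unfolding w_def by blast
    with ve sep show False by simp
  qed
  moreover have "\<forall>e. c' e \<le> (card P)\<^sup>2" using c(1) t(1) by (simp add: c'_def)
  ultimately show ?case using c'_sum by (intro exI[of _ c']) auto
qed

text \<open>Each pair of distinct points gets its own separating solution. A separating combination
  of these satisfies the same relations by linearity; at most \<open>(card P)\<^sup>2\<close>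
  summands, coefficients of at most that size and entries bounded by \<open>K\<close> give the
  fourth power.\<close>

lemma exists_small_injective_solution:
  fixes z :: "'a \<Rightarrow> complex"
  assumes P: "finite P" and inj: "inj_on z P" and L: "L \<ge> 1"
  shows "\<exists>w. inj_on w P \<and> relations L P z \<subseteq> relations L P w \<and>
    (\<forall>p\<in>P. w p \<in> gauss_box (- int ((card P) ^ 4 * (2 * L) ^ (card P - 1)))
                            (int ((card P) ^ 4 * (2 * L) ^ (card P - 1))))"
proof -
  define K where "K = (2 * L) ^ (card P - 1) - 1"
  have K: "K + 1 = (2 * L) ^ (card P - 1)" using L by (simp add: K_def)
  define E where "E = {(j, k). j \<in> P \<and> k \<in> P \<and> j \<noteq> k}"
  have EP: "E \<subseteq> P \<times> P" by (auto simp: E_def)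
  then have finE: "finite E" using P finite_subset by blast
  have cardE: "card E \<le> (card P)\<^sup>2"
    using card_mono[OF _ EP] P by (simp add: card_cartesian_product power2_eq_square)
  have "\<forall>e\<in>E. \<exists>v. v (fst e) \<noteq> v (snd e) \<and> relations L P z \<subseteq> relations L P v \<and>
    (\<forall>p\<in>P. v p \<in> gauss_box (- int K) (int K))"
  proof
    fix e assume "e \<in> E"
    then have e: "fst e \<in> P" "snd e \<in> P" "fst e \<noteq> snd e" by (auto simp: E_def)
    then have "z (fst e) \<noteq> z (snd e)" using inj_onD[OF inj] by blast
    with e(1,2)
    show "\<exists>v. v (fst e) \<noteq> v (snd e) \<and> relations L P z \<subseteq> relations L P v \<and>
        (\<forall>p\<in>P. v p \<in> gauss_box (- int K) (int K))"
      by (rule exists_small_separating_solution[OF P _ _ L _ K])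
  qed
  then obtain v where "\<forall>e\<in>E. v e (fst e) \<noteq> v e (snd e) \<and>
    relations L P z \<subseteq> relations L P (v e) \<and> (\<forall>p\<in>P. v e p \<in> gauss_box (- int K) (int K))"
    by (rule bchoice[elim_format]) blast
  then have v: "\<And>e. e \<in> E \<Longrightarrow> v e (fst e) \<noteq> v e (snd e)"
    "\<And>e. e \<in> E \<Longrightarrow> relations L P z \<subseteq> relations L P (v e)"
    "\<And>e p. e \<in> E \<Longrightarrow> p \<in> P \<Longrightarrow> v e p \<in> gauss_box (- int K) (int K)"
    by blast+
  obtain c :: "'a \<times> 'a \<Rightarrow> nat" where c: "\<And>e. c e \<le> (card P)\<^sup>2"
    "\<forall>p\<in>P. \<forall>q\<in>P. (\<exists>e\<in>E. v e p \<noteq> v e q) \<longrightarrow>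
      (\<Sum>e\<in>E. of_nat (c e) * v e p) \<noteq> (\<Sum>e\<in>E. of_nat (c e) * v e q)"
    using exists_separating_combination[OF P finE, of v] by blast
  define w where "w = (\<lambda>p. \<Sum>e\<in>E. of_nat (c e) * v e p)"
  have "inj_on w P"
  proof (rule inj_onI, rule ccontr)
    fix p q assume pq: "p \<in> P" "q \<in> P" "w p = w q" "p \<noteq> q"
    then have e: "(p, q) \<in> E" by (simp add: E_def)
    then have "\<exists>e\<in>E. v e p \<noteq> v e q" using v(1)[OF e] by auto
    with c(2) pq show False unfolding w_def by blast
  qed
  moreover have "relations L P z \<subseteq> relations L P w"
  proof
    fix d assume d: "d \<in> relations L P z"
    have "(\<Sum>p\<in>P. d p * w p) = (\<Sum>e\<in>E. of_nat (c e) * (\<Sum>p\<in>P. d p * v e p))"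
      unfolding w_def sum_distrib_left by (subst sum.swap) (simp add: algebra_simps)
    also have "\<dots> = 0" using v(2) d relations_eq_zero by (intro sum.neutral) fastforce
    finally show "d \<in> relations L P w" using d relations_transfer by blast
  qed
  moreover have "w p \<in> gauss_box (- int ((card P) ^ 4 * (2 * L) ^ (card P - 1)))
                            (int ((card P) ^ 4 * (2 * L) ^ (card P - 1)))" if p: "p \<in> P" for p
  proof -
    have vb: "Re (v e p) \<in> \<int>" "Im (v e p) \<in> \<int>" "\<bar>Re (v e p)\<bar> \<le> real K" "\<bar>Im (v e p)\<bar> \<le> real K"
      if "e \<in> E" for e using v(3)[OF that p] by (auto simp: gauss_box_iff)
    have sum_le: "\<bar>\<Sum>e\<in>E. real (c e) * r e\<bar> \<le> real ((card P) ^ 4 * (2 * L) ^ (card P - 1))"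
      if r: "\<And>e. e \<in> E \<Longrightarrow> \<bar>r e\<bar> \<le> real K" for r
    proof -
      have "\<bar>\<Sum>e\<in>E. real (c e) * r e\<bar> \<le> (\<Sum>e\<in>E. \<bar>real (c e) * r e\<bar>)" by (rule sum_abs)
      also have "\<dots> \<le> (\<Sum>e\<in>E. real ((card P)\<^sup>2) * real K)"
        unfolding abs_mult using r c(1) by (intro sum_mono mult_mono) auto
      also have "\<dots> = real (card E * (card P)\<^sup>2 * K)" by simp
      also have "\<dots> \<le> real ((card P)\<^sup>2 * (card P)\<^sup>2 * (2 * L) ^ (card P - 1))"
        using cardE K by (intro of_nat_mono mult_mono) auto
      also have "(card P)\<^sup>2 * (card P)\<^sup>2 = (card P) ^ 4" by (simp flip: power_add)
      finally show ?thesis .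
    qed
    have "Re (w p) = (\<Sum>e\<in>E. real (c e) * Re (v e p))" "Im (w p) = (\<Sum>e\<in>E. real (c e) * Im (v e p))"
      by (simp_all add: w_def)
    moreover have "(\<Sum>e\<in>E. real (c e) * Re (v e p)) \<in> \<int>" "(\<Sum>e\<in>E. real (c e) * Im (v e p)) \<in> \<int>"
      using vb by (auto intro!: Ints_sum)
    moreover have "\<bar>\<Sum>e\<in>E. real (c e) * Re (v e p)\<bar> \<le> real ((card P) ^ 4 * (2 * L) ^ (card P - 1))"
      "\<bar>\<Sum>e\<in>E. real (c e) * Im (v e p)\<bar> \<le> real ((card P) ^ 4 * (2 * L) ^ (card P - 1))"
      by (rule sum_le, rule vb, assumption)+
    ultimately show ?thesis unfolding gauss_box_iff abs_le_iff by simp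
  qed
  ultimately show ?thesis by blast
qed

section \<open>Squares in complex coordinates\<close>

definition to_complex :: "real ^ 2 \<Rightarrow> complex" where
  "to_complex p = Complex (p $ 1) (p $ 2)"

lemma inj_to_complex: "inj to_complex"
  by (rule injI) (simp add: to_complex_def vec_eq_iff forall_2)

lemma to_complex_diff: "to_complex (p - q) = to_complex p - to_complex q"
  by (simp add: to_complex_def complex_eq_iff)

text \<open>In the plane, \<open>w\<close> is \<open>v\<close> turned by a right angle in one of the
  two directions; for \<open>v = 0\<close> both sides say \<open>w = 0\<close>.\<close>

lemma orthogonal_same_norm_iff:
  "orthogonal v w \<and> norm v = norm w \<longleftrightarrow>
    to_complex w = \<i> * to_complex v \<or> to_complex w = - \<i> * to_complex v"
proof -
  have norm_eq: "norm v = norm w \<longleftrightarrow> (v$1)\<^sup>2 + (v$2)\<^sup>2 = (w$1)\<^sup>2 + (w$2)\<^sup>2"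
    by (simp add: norm_eq inner_vec_def sum_2 power2_eq_square)
  have "orthogonal v w \<longleftrightarrow> v$1 * w$1 + v$2 * w$2 = 0"
    by (simp add: orthogonal_def inner_vec_def sum_2)
  moreover have "a * c + b * d = 0 \<and> a\<^sup>2 + b\<^sup>2 = c\<^sup>2 + d\<^sup>2 \<longleftrightarrow>
      c = - b \<and> d = a \<or> c = b \<and> d = - a" for a b c d :: real
  proof
    assume h: "a * c + b * d = 0 \<and> a\<^sup>2 + b\<^sup>2 = c\<^sup>2 + d\<^sup>2"
    \<comment> \<open>If the common factor vanishes, all four numbers are 0. Otherwise the
      coordinates agree up to sign, and orthogonality correlates the signs.\<close>
    have "(a\<^sup>2 + b\<^sup>2) * (d\<^sup>2 - a\<^sup>2) = 0" using h by algebra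
    moreover have "(a\<^sup>2 + b\<^sup>2) * (c\<^sup>2 - b\<^sup>2) = 0" using h by algebra
    ultimately have "d\<^sup>2 = a\<^sup>2 \<and> c\<^sup>2 = b\<^sup>2"
      using h by (auto simp: sum_power2_eq_zero_iff)
    then have "(d = a \<or> d = - a) \<and> (c = b \<or> c = - b)" by (simp add: power2_eq_iff)
    then show "c = - b \<and> d = a \<or> c = b \<and> d = - a" using h by (auto simp: algebra_simps)
  qed (auto simp: power2_eq_square)
  ultimately show ?thesis unfolding norm_eq
    by (simp add: to_complex_def complex_eq_iff)
qed

text \<open>Exchanging the two neighbours of \<open>a\<close> turns a clockwise labelling into a
  counterclockwise one, so a single pair of linear equations with fixed coefficients covers both
  orientations.\<close>

lemma is_square_iff:
  "is_square Q \<longleftrightarrow> (\<exists>a b c d. a \<noteq> b \<and> Q = {a, b, c, d} \<and>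
     to_complex d - to_complex a = \<i> * (to_complex b - to_complex a) \<and>
     to_complex c - to_complex b = to_complex d - to_complex a)" (is "_ = ?R")
proof
  assume "is_square Q"
  then obtain a v w where v: "v \<noteq> 0" and o: "orthogonal v w \<and> norm v = norm w"
    and Q: "Q = {a, a + v, a + v + w, a + w}"
    unfolding is_square_def by blast
  have add: "to_complex (x + y) = to_complex x + to_complex y" for x y
    by (simp add: to_complex_def complex_eq_iff)
  from o have "to_complex w = \<i> * to_complex v \<or> to_complex w = - \<i> * to_complex v"
    by (simp only: orthogonal_same_norm_iff)
  then show ?R
  proof
    assume "to_complex w = \<i> * to_complex v"
    with v show ?R unfolding Q
      by (intro exI[of _ a] exI[of _ "a + v"] exI[of _ "a + v + w"] exI[of _ "a + w"])
        (auto simp: add)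
  next
    \<comment> \<open>Here \<open>to_complex v = \<i> * to_complex w\<close>, so \<open>v\<close>
      and \<open>w\<close> exchange roles.\<close>
    assume "to_complex w = - \<i> * to_complex v"
    moreover have "w \<noteq> 0" using v o by auto
    ultimately show ?R unfolding Q
      by (intro exI[of _ a] exI[of _ "a + w"] exI[of _ "a + v + w"] exI[of _ "a + v"])
        (auto simp: add)
  qed
next
  assume ?R
  then obtain a b c d where h: "a \<noteq> b" "Q = {a, b, c, d}"
    "to_complex (d - a) = \<i> * to_complex (b - a)" "to_complex (c - b) = to_complex (d - a)"
    by (auto simp: to_complex_diff)
  have "c = b + (d - a)" using injD[OF inj_to_complex h(4)] by (simp add: algebra_simps)
  moreover have "orthogonal (b - a) (d - a) \<and> norm (b - a) = norm (d - a)"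
    unfolding orthogonal_same_norm_iff using h(3) by simp
  ultimately have "b - a \<noteq> 0 \<and> orthogonal (b - a) (d - a) \<and> norm (b - a) = norm (d - a) \<and>
      Q = {a, a + (b - a), a + (b - a) + (d - a), a + (d - a)}"
    using h(1,2) by simp
  then show "is_square Q" unfolding is_square_def by blast
qed

section \<open>Transfer of squares along linear relations\<close>

text \<open>The four points may coincide, so the coefficient vector \<open>m\<close> adds the
  contributions at each point; by the triangle inequality its size does not exceed the total of the
  four.\<close>

lemma four_term_relation_transfer:
  fixes z w :: "'a \<Rightarrow> complex"
  assumes P: "finite P" "a \<in> P" "b \<in> P" "c \<in> P" "d \<in> P"
    and coeffs: "\<alpha> \<in> {x. Re x \<in> \<int> \<and> Im x \<in> \<int>}" "\<beta> \<in> {x. Re x \<in> \<int> \<and> Im x \<in> \<int>}"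
      "\<gamma> \<in> {x. Re x \<in> \<int> \<and> Im x \<in> \<int>}" "\<delta> \<in> {x. Re x \<in> \<int> \<and> Im x \<in> \<int>}"
    and L: "\<bar>Re \<alpha>\<bar> + \<bar>Im \<alpha>\<bar> + (\<bar>Re \<beta>\<bar> + \<bar>Im \<beta>\<bar>) + (\<bar>Re \<gamma>\<bar> + \<bar>Im \<gamma>\<bar>) + (\<bar>Re \<delta>\<bar> + \<bar>Im \<delta>\<bar>) \<le> real L"
    and sub: "relations L P z \<subseteq> relations L P w"
    and z: "\<alpha> * z a + \<beta> * z b + \<gamma> * z c + \<delta> * z d = 0"
  shows "\<alpha> * w a + \<beta> * w b + \<gamma> * w c + \<delta> * w d = 0"
proof -
  define m where "m = restrict (\<lambda>p. (if p = a then \<alpha> else 0) + (if p = b then \<beta> else 0)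
    + (if p = c then \<gamma> else 0) + (if p = d then \<delta> else 0)) P"
  have m_sum: "(\<Sum>p\<in>P. m p * y p) = \<alpha> * y a + \<beta> * y b + \<gamma> * y c + \<delta> * y d" for y
  proof -
    have "(\<Sum>p\<in>P. m p * y p) = (\<Sum>p\<in>P. (if p = a then \<alpha> * y p else 0) + (if p = b then \<beta> * y p else 0)
      + (if p = c then \<gamma> * y p else 0) + (if p = d then \<delta> * y p else 0))"
      by (rule sum.cong) (auto simp: m_def algebra_simps)
    then show ?thesis using P by (simp add: sum.distrib)
  qed
  define N where "N = (\<lambda>x::complex. \<bar>Re x\<bar> + \<bar>Im x\<bar>)"
  have N_add: "N (x + y) \<le> N x + N y" for x y by (simp add: N_def)
  have N_if: "N (if A then x else 0) = (if A then N x else 0)" for A x by (simp add: N_def)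
  have "(\<Sum>p\<in>P. N (m p)) \<le> (\<Sum>p\<in>P. (if p = a then N \<alpha> else 0) + (if p = b then N \<beta> else 0)
      + (if p = c then N \<gamma> else 0) + (if p = d then N \<delta> else 0))"
  proof (rule sum_mono)
    fix p assume "p \<in> P"
    then have "N (m p) = N ((if p = a then \<alpha> else 0) + (if p = b then \<beta> else 0)
      + (if p = c then \<gamma> else 0) + (if p = d then \<delta> else 0))" by (simp add: m_def)
    also have "\<dots> \<le> N (if p = a then \<alpha> else 0) + N (if p = b then \<beta> else 0)
      + N (if p = c then \<gamma> else 0) + N (if p = d then \<delta> else 0)"
      by (meson N_add add_right_mono order_trans)
    finally show "N (m p) \<le> (if p = a then N \<alpha> else 0) + (if p = b then N \<beta> else 0)
      + (if p = c then N \<gamma> else 0) + (if p = d then N \<delta> else 0)" by (simp only: N_if)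
  qed
  also have "\<dots> = N \<alpha> + N \<beta> + N \<gamma> + N \<delta>" using P by (simp add: sum.distrib)
  also have "\<dots> \<le> real L" using L by (simp add: N_def)
  finally have "(\<Sum>p\<in>P. \<bar>Re (m p)\<bar> + \<bar>Im (m p)\<bar>) \<le> real L" by (simp add: N_def)
  moreover have "m \<in> P \<rightarrow>\<^sub>E {x. Re x \<in> \<int> \<and> Im x \<in> \<int>}"
    using coeffs by (auto simp: m_def)
  ultimately have "m \<in> relations L P z" using z by (simp add: relations_def m_sum)
  then have "m \<in> relations L P w" using sub by blast
  then show ?thesis using relations_eq_zero m_sum by metis
qed

text \<open>The two equations of a square have coefficients \<open>\<i> - 1, - \<i>, 0, 1\<close>
  and \<open>1, - 1, 1, - 1\<close>, each of total size 4; this is why \<open>L = 4\<close>.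
  Injectivity keeps the image nondegenerate.\<close>

lemma is_square_image:
  fixes f :: "real ^ 2 \<Rightarrow> real ^ 2"
  assumes P: "finite P" and inj: "inj_on f P"
    and sub: "relations 4 P to_complex \<subseteq> relations 4 P (to_complex \<circ> f)"
    and Q: "Q \<subseteq> P" "is_square Q"
  shows "is_square (f ` Q)"
proof -
  obtain a b c d where h: "a \<noteq> b" "Q = {a, b, c, d}"
    "to_complex d - to_complex a = \<i> * (to_complex b - to_complex a)"
    "to_complex c - to_complex b = to_complex d - to_complex a"
    using Q(2) unfolding is_square_iff by blast
  have mem: "a \<in> P" "b \<in> P" "c \<in> P" "d \<in> P" using h(2) Q(1) by auto
  have "f a \<noteq> f b" using inj h(1) mem by (auto simp: inj_on_def)
  moreover have "(\<i> - 1) * (to_complex \<circ> f) a + (- \<i>) * (to_complex \<circ> f) b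
      + 0 * (to_complex \<circ> f) c + 1 * (to_complex \<circ> f) d = 0"
    using h(3) by (intro four_term_relation_transfer[OF P mem _ _ _ _ _ sub])
      (auto simp: algebra_simps)
  moreover have "1 * (to_complex \<circ> f) a + (- 1) * (to_complex \<circ> f) b
      + 1 * (to_complex \<circ> f) c + (- 1) * (to_complex \<circ> f) d = 0"
    using h(4) by (intro four_term_relation_transfer[OF P mem _ _ _ _ _ sub])
      (auto simp: algebra_simps)
  ultimately show ?thesis unfolding is_square_iff h(2)
    by (intro exI[of _ "f a"] exI[of _ "f b"] exI[of _ "f c"] exI[of _ "f d"])
      (auto simp: algebra_simps)
qed

lemma is_square_translate: "is_square Q \<Longrightarrow> is_square ((\<lambda>p. p + t) ` Q)"
  unfolding is_square_def
proof (elim exE conjE)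
  fix a v w :: "real ^ 2"
  assume "v \<noteq> 0" "orthogonal v w" "norm v = norm w" "Q = {a, a + v, a + v + w, a + w}"
  then show "\<exists>a v w. v \<noteq> 0 \<and> orthogonal v w \<and> norm v = norm w \<and>
      (\<lambda>p. p + t) ` Q = {a, a + v, a + v + w, a + w}"
    by (intro exI[of _ "a + t"] exI[of _ v] exI[of _ w]) (auto simp: algebra_simps)
qed

text \<open>Taking images under \<open>f\<close> is injective on subsets of \<open>P\<close>, so
  distinct squares have distinct images.\<close>

lemma num_squares_image_ge:
  assumes P: "finite P" and inj: "inj_on f P"
    and sq: "\<And>Q. Q \<subseteq> P \<Longrightarrow> is_square Q \<Longrightarrow> is_square (f ` Q)"
  shows "num_squares P \<le> num_squares (f ` P)"
  unfolding num_squares_def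
proof (rule card_inj_on_le[of "(`) f"])
  show "inj_on ((`) f) {Q. Q \<subseteq> P \<and> is_square Q}"
    using inj_on_image_Pow[OF inj] by (auto simp: inj_on_def)
  show "(`) f ` {Q. Q \<subseteq> P \<and> is_square Q} \<subseteq> {Q. Q \<subseteq> f ` P \<and> is_square Q}"
    using sq by auto
  show "finite {Q. Q \<subseteq> f ` P \<and> is_square Q}"
    by (rule finite_subset[of _ "Pow (f ` P)"]) (use P in auto)
qed

section \<open>The numerical bound and the final assembly\<close>

lemma quartic_times_power_le:
  fixes n :: nat
  assumes "n \<ge> 1"
  shows "2 * (n ^ 4 * 8 ^ (n - 1)) \<le> 25 ^ n"
proof (cases "n \<ge> 4")
  case True
  then show ?thesis
  proof (induction n rule: nat_induct_at_least)
    case base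
    show ?case by simp
  next
    case (Suc n)
    \<comment> \<open>For \<open>n \<ge> 4\<close> the ratio of \<open>Suc n\<close> to
      \<open>n\<close> is at most 5/4, and 8 times its fourth power, 8 * 625/256, is below
      25.\<close>
    have "4 * Suc n \<le> 5 * n" using Suc.hyps by simp
    then have "(4 * Suc n) ^ 4 \<le> (5 * n) ^ 4" by (rule power_mono) simp
    then have "256 * Suc n ^ 4 \<le> 625 * n ^ 4" by (simp only: power_mult_distrib) simp
    then have q: "8 * Suc n ^ 4 \<le> 25 * n ^ 4" by linarith
    obtain k where k: "n = Suc k" using Suc.hyps by (cases n) auto
    have "2 * (Suc n ^ 4 * 8 ^ n) = 2 * (8 * Suc n ^ 4) * 8 ^ k" by (simp add: k)
    also have "\<dots> \<le> 2 * (25 * n ^ 4) * 8 ^ k" by (intro mult_le_mono order_refl q)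
    also have "\<dots> = 25 * (2 * (n ^ 4 * 8 ^ (n - 1)))" by (simp add: k)
    also have "\<dots> \<le> 25 * 25 ^ n" using Suc.IH by (rule mult_le_mono2)
    finally show ?case by (simp only: diff_Suc_1 power_Suc)
  qed
next
  case False
  with assms have "n = 1 \<or> n = 2 \<or> n = 3" by auto
  then show ?thesis by auto
qed

theorem proposition32:
  fixes n :: nat and P :: "(real ^ 2) set"
  assumes "n \<ge> 1" and "finite P" and "card P = n"
  shows "\<exists>\<Lambda>::nat. \<Lambda> \<le> 25 ^ n \<and>
           (\<exists>P'. P' \<subseteq> grid \<Lambda> \<and> finite P' \<and> card P' = n \<and>
                 num_squares P' \<ge> num_squares P)"
proof -
  \<comment> \<open>The coordinate bound for \<open>L = 4\<close>, where
    \<open>2 * L = 8\<close>.\<close>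
  define M where "M = n ^ 4 * 8 ^ (n - 1)"
  obtain w where w: "inj_on w P" "relations 4 P to_complex \<subseteq> relations 4 P w"
    "\<And>p. p \<in> P \<Longrightarrow> w p \<in> gauss_box (- int M) (int M)"
  proof -
    have "inj_on to_complex P" using inj_to_complex by (rule inj_on_subset) simp
    from exists_small_injective_solution[OF assms(2) this, of 4] that show thesis
      unfolding assms(3) M_def by auto
  qed
  define f :: "real ^ 2 \<Rightarrow> real ^ 2" where "f = (\<lambda>p. vector [Re (w p), Im (w p)])"
  have fw: "to_complex \<circ> f = w"
    by (auto simp: f_def to_complex_def)
  have inj_f: "inj_on f P" using w(1) fw inj_on_imageI2 by metis
  \<comment> \<open>Translation by \<open>M\<close> in both coordinates makes them nonnegative,
    which gives \<open>\<Lambda> = 2 * M\<close>.\<close>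
  define t :: "real ^ 2" where "t = vector [real M, real M]"
  define g where "g = (\<lambda>p. f p + t)"
  have inj_g: "inj_on g P" using inj_f by (auto simp: inj_on_def g_def)
  have "is_square (g ` Q)" if "Q \<subseteq> P" "is_square Q" for Q
    using is_square_translate[OF is_square_image[OF assms(2) inj_f _ that], of t] w(2) fw
    by (simp add: g_def image_image)
  then have "num_squares P \<le> num_squares (g ` P)"
    by (rule num_squares_image_ge[OF assms(2) inj_g])
  moreover have "g ` P \<subseteq> grid (2 * M)"
  proof -
    have shift: "x + real M \<in> real ` {0..2 * M}"
      if "x \<in> \<int>" "- real M \<le> x" "x \<le> real M" for x
    proof -
      from that obtain i where i: "x = of_int i" by (auto elim: Ints_cases)
      with that have "- int M \<le> i" "i \<le> int M" by linarith+
      then have "nat (i + int M) \<in> {0..2 * M}" "x + real M = real (nat (i + int M))"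
        using i by auto
      then show ?thesis by blast
    qed
    have "g p \<in> grid (2 * M)" if "p \<in> P" for p
      using w(3)[OF that]
      by (simp add: grid_def g_def f_def t_def forall_2 gauss_box_iff shift)
    then show ?thesis by blast
  qed
  moreover have "2 * M \<le> 25 ^ n" using quartic_times_power_le[OF assms(1)] by (simp add: M_def)
  moreover have "card (g ` P) = n" using card_image[OF inj_g] assms(3) by simp
  moreover have "finite (g ` P)" using assms(2) by simp
  ultimately show ?thesis by blast
qed

end
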